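(* Let $r,n$ be positive integers with $r\equiv2\pmod4$, let $\pi\in A_{r,n}$ and let $p(\pi)$ be its projection into $G_{\frac r2,n}$. Then $$\ell_{\mathcal A}(\pi)=\ell_F(\pi)+\ell_G(p(\pi)).$$
   Context: For positive integers $m,n$, $G_{m,n}=\mathbb{Z}_m\wr S_n$ is the set of pairs $(\vec z,\tau)$ with $\vec z=(z_1,\dots,z_n)\in\{0,\dots,m-1\}^n$, $\tau\in S_n$, with product $(\vec z,\tau)(\vec z',\tau')=((z_1+z'_{\tau^{-1}(1)},\dots,z_n+z'_{\tau^{-1}(n)}),\tau\circ\tau')$, addition mod $m$. For $\pi=(\vec z,\tau)$: $|\pi|=(\vec0,\tau)$ is identified with $\tau$; $c_i(\pi)=z_{\tau(i)}$ is the color of the digit in place $i$; the window notation is $\pi=(\tau(1)^{[c_1]}\cdots\tau(n)^{[c_n]})$. The generator $s_0$ of $G_{m,n}$ is the pair with vector $(1,0,\dots,0)$ (mod $m$) and identity permutation; for $1\le i\le n-1$, $s_i$ is the pair with zero vector and transposition $(i\ i+1)$. $\ell_G$ denotes the length function of $G_{\frac r2,n}$: $\ell_G(\rho)$ is the minimal number of generators from $\{s_0,\dots,s_{n-1}\}\subset G_{\frac r2,n}$ whose product is $\rho$. $A_{r,n}$ is the kernel of the homomorphism $G_{r,n}\to\{\pm1\}$ sending every $s_i$, $0\le i\le n-1$, to $-1$. In $G_{r,n}$ put $a_0=s_0^2$, $a_i=s_0^{r/2}s_i$ for $1\le i\le n-1$, and $\mathcal A=\{a_0,a_1,a_1^{-1},a_2,\dots,a_{n-1}\}$,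 a generating set of $A_{r,n}$; $\ell_{\mathcal A}(\pi)$ is the minimal $u$ such that $\pi$ is a product of $u$ elements of $\mathcal A$. For a nonnegative integer $a$, $a\oslash 2\in\{0,\dots,\frac r2-1\}$ is the residue modulo $\frac r2$ of $\frac a2$ if $a$ is even, and of $\frac{a+r/2}{2}$ if $a$ is odd. The covering map $p:A_{r,n}\to G_{\frac r2,n}$ is $p((b_1^{[c_1]}\cdots b_n^{[c_n]}))=(b_1^{[c_1\oslash2]}\cdots b_n^{[c_n\oslash2]})$. Its section $s:G_{\frac r2,n}\to A_{r,n}$ is defined as follows: for $\pi=(p_1^{[c_1]}\cdots p_n^{[c_n]})$ with $p_j=1$, $s(\pi)=(p_1^{[2c_1]}\cdots p_n^{[2c_n]})$ if the usual inversion number $\mathrm{inv}(|\pi|)$ is even, and if $\mathrm{inv}(|\pi|)$ is odd, $s(\pi)$ is the same except that the color of $p_j=1$ is $2c_j+\frac r2$ (colors computed mod $r$). For $\pi\in A_{r,n}$ the fibral length is $\ell_F(\pi)=\ell_{\mathcal A}(\pi)-\ell_{\mathcal A}(s(p(\pi)))$. *)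

theory Defs
  imports "HOL-Algebra.Sym_Groups" "HOL-Number_Theory.Cong"
begin

section \<open>The colored permutation group\<close>

text \<open>
  A color vector is a function on the positions \<open>{1..n}\<close> with values in \<open>{0..<m}\<close>, made
  extensional (\<open>undefined\<close> outside \<open>{1..n}\<close>) so that equality of group elements is
  equality of pairs.
\<close>

definition colored_perm_group :: "nat \<Rightarrow> nat \<Rightarrow> ((nat \<Rightarrow> nat) \<times> (nat \<Rightarrow> nat)) monoid" where
  "colored_perm_group m n =
     \<lparr> carrier = ({1..n} \<rightarrow>\<^sub>E {0..<m}) \<times> {\<tau>. \<tau> permutes {1..n}},
       mult = (\<lambda>(z, \<tau>) (z', \<tau>').
                (\<lambda>i\<in>{1..n}. (z i + z' (inv_into UNIV \<tau> i)) mod m, \<tau> \<circ> \<tau>')),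
       one = (\<lambda>i\<in>{1..n}. 0, id) \<rparr>"

text \<open>Reducing \<open>1\<close> modulo \<open>m\<close> matters only for \<open>m = 1\<close>, where \<open>s\<^sub>0\<close> is the identity.\<close>

definition cgen :: "nat \<Rightarrow> nat \<Rightarrow> nat \<Rightarrow> (nat \<Rightarrow> nat) \<times> (nat \<Rightarrow> nat)" where
  "cgen m n i =
     (if i = 0 then (\<lambda>k\<in>{1..n}. if k = 1 then 1 mod m else 0, id)
      else (\<lambda>k\<in>{1..n}. 0, Transposition.transpose i (i + 1)))"

text \<open>
  Word length as a monoid: inverses of elements of \<open>S\<close> may be used only if they belong to \<open>S\<close>.
\<close>

definition word_length :: "('a, 'b) monoid_scheme \<Rightarrow> 'a set \<Rightarrow> 'a \<Rightarrow> nat" where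
  "word_length G S x =
     (LEAST k. \<exists>ws. length ws = k \<and> set ws \<subseteq> S \<and> foldr (\<lambda>a b. a \<otimes>\<^bsub>G\<^esub> b) ws \<one>\<^bsub>G\<^esub> = x)"

definition length_G :: "nat \<Rightarrow> nat \<Rightarrow> (nat \<Rightarrow> nat) \<times> (nat \<Rightarrow> nat) \<Rightarrow> nat" where
  "length_G m n = word_length (colored_perm_group m n) (cgen m n ` {0..<n})"


section \<open>The alternating subgroup and its generators\<close>

text \<open>
  Homomorphisms are only determined on the carrier, hence the extensionality condition. That
  the description is proper for even \<open>m\<close> is lemma \<open>sign_char_unique\<close> below.
\<close>

definition is_sign_char :: "nat \<Rightarrow> nat \<Rightarrow> ((nat \<Rightarrow> nat) \<times> (nat \<Rightarrow> nat) \<Rightarrow> int) \<Rightarrow> bool" where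
  "is_sign_char m n \<chi> \<longleftrightarrow>
     \<chi> \<in> hom (colored_perm_group m n) sign_img \<and>
     \<chi> \<in> extensional (carrier (colored_perm_group m n)) \<and>
     (\<forall>i<n. \<chi> (cgen m n i) = -1)"

definition sign_char :: "nat \<Rightarrow> nat \<Rightarrow> (nat \<Rightarrow> nat) \<times> (nat \<Rightarrow> nat) \<Rightarrow> int" where
  "sign_char m n = (THE \<chi>. is_sign_char m n \<chi>)"

definition alt_colored :: "nat \<Rightarrow> nat \<Rightarrow> ((nat \<Rightarrow> nat) \<times> (nat \<Rightarrow> nat)) set" where
  "alt_colored r n = kernel (colored_perm_group r n) sign_img (sign_char r n)"

definition agen :: "nat \<Rightarrow> nat \<Rightarrow> nat \<Rightarrow> (nat \<Rightarrow> nat) \<times> (nat \<Rightarrow> nat)" where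
  "agen r n i =
     (if i = 0 then cgen r n 0 [^]\<^bsub>colored_perm_group r n\<^esub> (2::nat)
      else (cgen r n 0 [^]\<^bsub>colored_perm_group r n\<^esub> (r div 2))
             \<otimes>\<^bsub>colored_perm_group r n\<^esub> cgen r n i)"

text \<open>For \<open>n = 1\<close> there is no \<open>a\<^sub>1\<close>, and the generating set is \<open>{a\<^sub>0}\<close>.\<close>

definition alt_gens :: "nat \<Rightarrow> nat \<Rightarrow> ((nat \<Rightarrow> nat) \<times> (nat \<Rightarrow> nat)) set" where
  "alt_gens r n =
     agen r n ` {0..<n} \<union> (if 2 \<le> n then {inv\<^bsub>colored_perm_group r n\<^esub> (agen r n 1)} else {})"

definition length_A :: "nat \<Rightarrow> nat \<Rightarrow> (nat \<Rightarrow> nat) \<times> (nat \<Rightarrow> nat) \<Rightarrow> nat" where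
  "length_A r n = word_length (colored_perm_group r n) (alt_gens r n)"


section \<open>Window notation, covering map, section and fibral length\<close>

definition color :: "(nat \<Rightarrow> nat) \<times> (nat \<Rightarrow> nat) \<Rightarrow> nat \<Rightarrow> nat" where
  "color \<pi> i = fst \<pi> (snd \<pi> i)"

text \<open>
  \<open>window n b c\<close> is the element written \<open>(b(1)\<^sup>[c(1)] \<dots> b(n)\<^sup>[c(n)])\<close>: its color in place
  \<open>i\<close> is \<open>c i\<close>, so the digit \<open>k = b i\<close> carries the color \<open>c (b\<inverse> k)\<close>.
\<close>

definition window ::
  "nat \<Rightarrow> (nat \<Rightarrow> nat) \<Rightarrow> (nat \<Rightarrow> nat) \<Rightarrow> (nat \<Rightarrow> nat) \<times> (nat \<Rightarrow> nat)" where
  "window n b c = (\<lambda>k\<in>{1..n}. c (inv_into UNIV b k), b)"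

text \<open>\<open>half_color r a\<close> is \<open>a \<oslash> 2\<close>; for odd \<open>r/2\<close> both divisions by 2 are exact.\<close>

definition half_color :: "nat \<Rightarrow> nat \<Rightarrow> nat" where
  "half_color r a =
     (if even a then (a div 2) mod (r div 2) else ((a + r div 2) div 2) mod (r div 2))"

definition cover ::
  "nat \<Rightarrow> nat \<Rightarrow> (nat \<Rightarrow> nat) \<times> (nat \<Rightarrow> nat) \<Rightarrow> (nat \<Rightarrow> nat) \<times> (nat \<Rightarrow> nat)" where
  "cover r n \<pi> = window n (snd \<pi>) (\<lambda>i. half_color r (color \<pi> i))"

definition inversions :: "nat \<Rightarrow> (nat \<Rightarrow> nat) \<Rightarrow> nat" where
  "inversions n \<tau> = card {(i, j). 1 \<le> i \<and> i < j \<and> j \<le> n \<and> \<tau> i > \<tau> j}"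

definition cover_section ::
  "nat \<Rightarrow> nat \<Rightarrow> (nat \<Rightarrow> nat) \<times> (nat \<Rightarrow> nat) \<Rightarrow> (nat \<Rightarrow> nat) \<times> (nat \<Rightarrow> nat)" where
  "cover_section r n \<pi> =
     window n (snd \<pi>)
       (\<lambda>i. if odd (inversions n (snd \<pi>)) \<and> snd \<pi> i = 1
            then (2 * color \<pi> i + r div 2) mod r
            else (2 * color \<pi> i) mod r)"

definition fibral_length :: "nat \<Rightarrow> nat \<Rightarrow> (nat \<Rightarrow> nat) \<times> (nat \<Rightarrow> nat) \<Rightarrow> int" where
  "fibral_length r n \<pi> =
     int (length_A r n \<pi>) - int (length_A r n (cover_section r n (cover r n \<pi>)))"


section \<open>Well-definedness\<close>

lemma carrier_cpg:
  "carrier (colored_perm_group m n) = ({1..n} \<rightarrow>\<^sub>E {0..<m}) \<times> {\<tau>. \<tau> permutes {1..n}}"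
  by (simp add: colored_perm_group_def)

lemma mult_cpg:
  "(z, \<tau>) \<otimes>\<^bsub>colored_perm_group m n\<^esub> (z', \<tau>') =
     (\<lambda>i\<in>{1..n}. (z i + z' (inv_into UNIV \<tau> i)) mod m, \<tau> \<circ> \<tau>')"
  by (simp add: colored_perm_group_def)

lemma one_cpg: "\<one>\<^bsub>colored_perm_group m n\<^esub> = (\<lambda>i\<in>{1..n}. 0, id)"
  by (simp add: colored_perm_group_def)

lemma window_color:
  assumes "\<pi> \<in> carrier (colored_perm_group m n)"
  shows "window n (snd \<pi>) (color \<pi>) = \<pi>"
proof -
  obtain z t where p: "\<pi> = (z, t)" by (cases \<pi>)
  have t: "t permutes {1..n}" and z: "z \<in> {1..n} \<rightarrow>\<^sub>E {0..<m}"
    using assms by (auto simp: p carrier_cpg)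
  have "(\<lambda>k\<in>{1..n}. z (t (inv_into UNIV t k))) = z"
    using z by (auto simp: fun_eq_iff permutes_inverses[OF t] PiE_def extensional_def restrict_def)
  then show ?thesis by (simp add: p window_def color_def)
qed

lemma group_cpg:
  assumes "0 < m"
  shows "group (colored_perm_group m n)" (is "group ?G")
proof (rule groupI)
  fix x y assume xy: "x \<in> carrier ?G" "y \<in> carrier ?G"
  show "x \<otimes>\<^bsub>?G\<^esub> y \<in> carrier ?G"
    using xy assms by (cases x; cases y) (auto simp: carrier_cpg mult_cpg permutes_compose)
next
  show "\<one>\<^bsub>?G\<^esub> \<in> carrier ?G"
    using assms by (auto simp: carrier_cpg one_cpg permutes_id)
next
  fix x y w assume c: "x \<in> carrier ?G" "y \<in> carrier ?G" "w \<in> carrier ?G"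
  obtain z1 t1 z2 t2 z3 t3 where e: "x = (z1, t1)" "y = (z2, t2)" "w = (z3, t3)"
    by (metis surj_pair)
  have t1: "t1 permutes {1..n}" and t2: "t2 permutes {1..n}"
    using c by (auto simp: e carrier_cpg)
  have i: "inv_into UNIV (t1 \<circ> t2) k = inv_into UNIV t2 (inv_into UNIV t1 k)" for k
    by (simp add: o_inv_distrib permutes_bij[OF t1] permutes_bij[OF t2])
  have j: "inv_into UNIV t1 k \<in> {1..n}" if "k \<in> {1..n}" for k
    using permutes_in_image[OF permutes_inv[OF t1], of k] that by simp
  show "x \<otimes>\<^bsub>?G\<^esub> y \<otimes>\<^bsub>?G\<^esub> w = x \<otimes>\<^bsub>?G\<^esub> (y \<otimes>\<^bsub>?G\<^esub> w)"
    unfolding e mult_cpg prod.inject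
    by (intro conjI restrict_ext)
       (use j in \<open>auto simp: i restrict_apply mod_simps ac_simps o_assoc\<close>)
next
  fix x assume x: "x \<in> carrier ?G"
  obtain z t where e: "x = (z, t)" by (cases x)
  have t: "t permutes {1..n}" and z: "z \<in> {1..n} \<rightarrow>\<^sub>E {0..<m}"
    using x by (auto simp: e carrier_cpg)
  have zk: "z k < m" if "k \<in> {1..n}" for k using z that by auto
  show "\<one>\<^bsub>?G\<^esub> \<otimes>\<^bsub>?G\<^esub> x = x"
    using z zk by (auto simp: e one_cpg mult_cpg fun_eq_iff PiE_def extensional_def restrict_def)
  let ?y = "(\<lambda>k\<in>{1..n}. (m - z (t k)) mod m, inv_into UNIV t)"
  have tk: "t k \<in> {1..n}" if "k \<in> {1..n}" for k
    using permutes_in_image[OF t, of k] that by simp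
  have "?y \<in> carrier ?G"
    using assms permutes_inv[OF t] by (auto simp: carrier_cpg)
  moreover have "?y \<otimes>\<^bsub>?G\<^esub> x = \<one>\<^bsub>?G\<^esub>"
    unfolding e mult_cpg one_cpg prod.inject
  proof (intro conjI restrict_ext)
    fix i assume i: "i \<in> {1..n}"
    have "((m - z (t i)) mod m + z (t i)) mod m = (m - z (t i) + z (t i)) mod m"
      by (simp add: mod_simps)
    also have "\<dots> = 0" using zk[OF tk[OF i]] by simp
    finally show "((\<lambda>k\<in>{1..n}. (m - z (t k)) mod m) i
        + z (inv_into UNIV (inv_into UNIV t) i)) mod m = 0"
      using i by (simp add: permutes_inv_inv[OF t])
  qed (rule permutes_inv_o(2)[OF t])
  ultimately show "\<exists>y\<in>carrier ?G. y \<otimes>\<^bsub>?G\<^esub> x = \<one>\<^bsub>?G\<^esub>" by blast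
qed

lemma cgen_carrier:
  assumes "0 < m" "i < n"
  shows "cgen m n i \<in> carrier (colored_perm_group m n)"
  using assms by (auto simp: cgen_def carrier_cpg permutes_id intro!: permutes_swap_id)

lemma cgen_generate:
  assumes m: "0 < m" and x: "x \<in> carrier (colored_perm_group m n)"
    and one: "\<one>\<^bsub>colored_perm_group m n\<^esub> \<in> H"
    and gen: "\<And>i. i < n \<Longrightarrow> cgen m n i \<in> H"
    and mult: "\<And>u v. u \<in> H \<Longrightarrow> v \<in> H \<Longrightarrow> u \<otimes>\<^bsub>colored_perm_group m n\<^esub> v \<in> H"
  shows "x \<in> H"
proof -
  let ?zero = "\<lambda>k\<in>{1..n}. 0 :: nat"
  have comp: "(?zero, t \<circ> u) \<in> H"
    if "(?zero, t) \<in> H" "(?zero, u) \<in> H" "t permutes {1..n}" for t u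
  proof -
    have "inv_into UNIV t k \<in> {1..n}" if "k \<in> {1..n}" for k
      using permutes_in_image[OF permutes_inv[OF \<open>t permutes {1..n}\<close>], of k] that by simp
    then have "(?zero, t) \<otimes>\<^bsub>colored_perm_group m n\<^esub> (?zero, u) = (?zero, t \<circ> u)"
      unfolding mult_cpg by (auto intro!: restrict_ext)
    then show ?thesis using mult[OF that(1,2)] by simp
  qed
  have adj: "(?zero, apply_adj_transps xs) \<in> H" if "set xs \<subseteq> {1..<n}" for xs
    using that
  proof (induction xs)
    case Nil
    show ?case using one by (simp only: one_cpg apply_adj_transps_Nil)
  next
    case (Cons a xs)
    have "(?zero, Transposition.transpose a (a + 1)) \<in> H"
      using gen[of a] Cons.prems by (simp add: cgen_def)
    moreover have "Transposition.transpose a (a + 1) permutes {1..n}"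
      using Cons.prems by (intro permutes_swap_id) auto
    ultimately show ?case
      unfolding apply_adj_transps_Cons using Cons.IH Cons.prems by (intro comp; simp del: restrict_apply)
  qed
  have transp_less: "(?zero, Transposition.transpose a b) \<in> H"
    if "a \<in> {1..n}" "b \<in> {1..n}" "a < b" for a b
    using adj[of "adj_transp_seq a b"] that
    by (simp add: adj_transp_seq_correct set_adj_transp_seq)
  have transp: "(?zero, Transposition.transpose a b) \<in> H"
    if "a \<in> {1..n}" "b \<in> {1..n}" "a \<noteq> b" for a b
    using transp_less[of a b] transp_less[of b a] that
    by (cases a b rule: linorder_cases) (auto simp: transpose_commute)
  have perm: "(?zero, t) \<in> H" if "t permutes {1..n}" for t
    using that finite_atLeastAtMost[of 1 n]
  proof (induction rule: permutes_induct)
    case id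
    show ?case using one by (simp only: one_cpg)
  next
    case (swap a b p)
    then show ?case by (intro comp transp permutes_swap_id)
  qed
  have e1: "(\<lambda>k\<in>{1..n}. if k = 1 then c mod m else 0, id) \<in> H" if "1 \<le> n" for c
  proof (induction c)
    case 0
    have "(\<lambda>k\<in>{1..n}. if k = 1 then 0 mod m else 0) = ?zero" by (intro restrict_ext) simp
    then show ?case using one by (simp only: one_cpg)
  next
    case (Suc c)
    have *: "cgen m n 0 \<otimes>\<^bsub>colored_perm_group m n\<^esub> (\<lambda>k\<in>{1..n}. if k = 1 then c mod m else 0, id)
        = (\<lambda>k\<in>{1..n}. if k = 1 then Suc c mod m else 0, id)"
      by (auto simp: cgen_def mult_cpg mod_simps inv_id intro!: restrict_ext)
    have "0 < n" using that by simp
    from mult[OF gen[OF this] Suc] show ?case by (simp only: *)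
  qed
  have ej: "(\<lambda>k\<in>{1..n}. if k = j then c mod m else 0, id) \<in> H" if j: "j \<in> {1..n}" for c j
  proof (cases "j = 1")
    case True
    then show ?thesis using e1[of c] j by simp
  next
    case False
    let ?t = "Transposition.transpose 1 j"
    have t: "(?zero, ?t) \<in> H" using j False by (intro perm permutes_swap_id) auto
    have tk: "?t k \<in> {1..n}" if "k \<in> {1..n}" for k
      using that j by (auto simp: Transposition.transpose_def)
    have inv_t: "inv_into UNIV ?t = ?t" by simp
    have *: "(?zero, ?t) \<otimes>\<^bsub>colored_perm_group m n\<^esub>
        (\<lambda>k\<in>{1..n}. if k = 1 then c mod m else 0, id)
      = (\<lambda>k\<in>{1..n}. if k = j then c mod m else 0, ?t)"
      unfolding mult_cpg prod.inject inv_t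
    proof (intro conjI restrict_ext)
      fix i assume i: "i \<in> {1..n}"
      have "?t i = 1 \<longleftrightarrow> i = j" by (auto simp: Transposition.transpose_def)
      then show "((\<lambda>k\<in>{1..n}. 0) i + (\<lambda>k\<in>{1..n}. if k = 1 then c mod m else 0) (?t i)) mod m
          = (if i = j then c mod m else 0)"
        unfolding restrict_apply'[OF i] restrict_apply'[OF tk[OF i]] by simp
    qed simp
    have **: "(\<lambda>k\<in>{1..n}. if k = j then c mod m else 0, ?t)
        \<otimes>\<^bsub>colored_perm_group m n\<^esub> (?zero, ?t)
      = (\<lambda>k\<in>{1..n}. if k = j then c mod m else 0, id)"
      unfolding mult_cpg prod.inject inv_t
    proof (intro conjI restrict_ext)
      fix i assume i: "i \<in> {1..n}"
      show "((\<lambda>k\<in>{1..n}. if k = j then c mod m else 0) i + (\<lambda>k\<in>{1..n}. 0) (?t i)) mod m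
          = (if i = j then c mod m else 0)"
        unfolding restrict_apply'[OF i] restrict_apply'[OF tk[OF i]] by simp
    qed simp
    have "1 \<le> n" using j by simp
    from mult[OF mult[OF t e1[OF this, of c]] t] show ?thesis by (simp only: * **)
  qed
  obtain z t where e: "x = (z, t)" by (cases x)
  have t: "t permutes {1..n}" and z: "z \<in> {1..n} \<rightarrow>\<^sub>E {0..<m}"
    using x by (auto simp: e carrier_cpg)
  have zk: "z k < m" if "k \<in> {1..n}" for k using z that by auto
  have part: "(\<lambda>k\<in>{1..n}. if k \<in> A then z k else 0, id) \<in> H" if "finite A" "A \<subseteq> {1..n}" for A
    using that
  proof (induction A)
    case empty
    have "(\<lambda>k\<in>{1..n}. if k \<in> {} then z k else 0) = ?zero" by (intro restrict_ext) simp
    then show ?case using one by (simp only: one_cpg)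
  next
    case (insert a A)
    have *: "(\<lambda>k\<in>{1..n}. if k = a then z a mod m else 0, id) \<otimes>\<^bsub>colored_perm_group m n\<^esub>
        (\<lambda>k\<in>{1..n}. if k \<in> A then z k else 0, id)
      = (\<lambda>k\<in>{1..n}. if k \<in> insert a A then z k else 0, id)"
      unfolding mult_cpg prod.inject using insert.hyps zk
      by (auto simp: inv_id intro!: restrict_ext)
    have "a \<in> {1..n}" "A \<subseteq> {1..n}" using insert.prems by auto
    from mult[OF ej[OF this(1), of "z a"] insert.IH[OF this(2)]] show ?case by (simp only: *)
  qed
  have "(\<lambda>k\<in>{1..n}. if k \<in> {1..n} then z k else 0, id)
      \<otimes>\<^bsub>colored_perm_group m n\<^esub> (?zero, t) = x"
    using z zk
    by (auto simp: mult_cpg e inv_id fun_eq_iff PiE_def extensional_def restrict_def)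
  with mult[OF part[OF finite_atLeastAtMost subset_refl] perm[OF t]] show ?thesis
    by (simp only:)
qed

lemma minus_one_power_mod:
  assumes "even m" shows "(-1 :: int) ^ (a mod m) = (-1) ^ a"
proof -
  have "even (a mod m) \<longleftrightarrow> even a" using assms by (simp add: dvd_mod_iff)
  then show ?thesis by (simp add: minus_one_power_iff)
qed

lemma is_sign_char_explicit:
  assumes m: "0 < m" "even m"
  shows "is_sign_char m n
    (\<lambda>x\<in>carrier (colored_perm_group m n). (-1) ^ (\<Sum>i\<in>{1..n}. fst x i) * sign (snd x))"
    (is "is_sign_char m n ?\<chi>")
  unfolding is_sign_char_def
proof (intro conjI allI impI)
  let ?G = "colored_perm_group m n"
  interpret group ?G by (rule group_cpg[OF m(1)])
  show "?\<chi> \<in> hom ?G sign_img"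
  proof (rule homI)
    fix x assume "x \<in> carrier ?G"
    then show "?\<chi> x \<in> carrier sign_img"
      by (simp add: sign_img_def sign_def minus_one_power_iff)
  next
    fix x y assume xy: "x \<in> carrier ?G" "y \<in> carrier ?G"
    obtain z t w u where e: "x = (z, t)" "y = (w, u)" by (metis surj_pair)
    have t: "t permutes {1..n}" and u: "u permutes {1..n}"
      using xy by (auto simp: e carrier_cpg)
    have "(-1 :: int) ^ (\<Sum>i\<in>{1..n}. (z i + w (inv_into UNIV t i)) mod m)
        = (\<Prod>i\<in>{1..n}. (-1) ^ ((z i + w (inv_into UNIV t i)) mod m))"
      by (simp add: power_sum)
    also have "\<dots> = (\<Prod>i\<in>{1..n}. (-1) ^ z i) * (\<Prod>i\<in>{1..n}. (-1) ^ w (inv_into UNIV t i))"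
      by (simp add: minus_one_power_mod[OF m(2)] power_add prod.distrib)
    also have "(\<Prod>i\<in>{1..n}. (-1 :: int) ^ w (inv_into UNIV t i)) = (\<Prod>i\<in>{1..n}. (-1) ^ w i)"
      using prod.permute[OF permutes_inv[OF t], of "\<lambda>i. (-1 :: int) ^ w i"] by (simp add: o_def)
    finally have "(-1 :: int) ^ (\<Sum>i\<in>{1..n}. (z i + w (inv_into UNIV t i)) mod m)
        = (-1) ^ (\<Sum>i\<in>{1..n}. z i) * (-1) ^ (\<Sum>i\<in>{1..n}. w i)"
      by (simp add: power_sum)
    moreover have "sign (t \<circ> u) = sign t * sign u"
      by (intro sign_compose permutes_imp_permutation[OF _ t] permutes_imp_permutation[OF _ u]) auto
    moreover have "(\<Sum>i\<in>{1..n}. (\<lambda>i\<in>{1..n}. (z i + w (inv_into UNIV t i)) mod m) i)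
        = (\<Sum>i\<in>{1..n}. (z i + w (inv_into UNIV t i)) mod m)"
      by (intro sum.cong) auto
    ultimately show "?\<chi> (x \<otimes>\<^bsub>?G\<^esub> y) = ?\<chi> x \<otimes>\<^bsub>sign_img\<^esub> ?\<chi> y"
      using xy m_closed[OF xy] unfolding e mult_cpg
      by (subst (1 2 3) restrict_apply) (simp add: sign_img_def del: restrict_apply)
  qed
next
  fix i assume i: "i < n"
  have "(\<Sum>k\<in>{1..n}. fst (cgen m n i) k) = (\<Sum>k\<in>{1..n}. if k = 1 then (if i = 0 then 1 else 0) else 0)"
  proof (intro sum.cong refl)
    fix k assume "k \<in> {1..n}"
    moreover have "1 mod m = 1" using m by (auto elim!: evenE)
    ultimately show "fst (cgen m n i) k = (if k = 1 then (if i = 0 then 1 else 0) else 0)"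
      by (simp add: cgen_def)
  qed
  also have "\<dots> = (if i = 0 then 1 else 0)" using i by (subst sum.delta) auto
  finally show "?\<chi> (cgen m n i) = -1"
    unfolding restrict_apply'[OF cgen_carrier[OF m(1) i]]
    by (simp only:) (simp add: cgen_def sign_swap_id)
qed (rule restrict_extensional)

lemma sign_char_unique:
  assumes m: "0 < m" "even m"
  shows "\<exists>!\<chi>. is_sign_char m n \<chi>"
proof (rule ex_ex1I)
  show "\<exists>\<chi>. is_sign_char m n \<chi>" using is_sign_char_explicit[OF m] by blast
next
  fix \<chi> \<psi> assume a: "is_sign_char m n \<chi>" "is_sign_char m n \<psi>"
  let ?G = "colored_perm_group m n"
  have h: "group_hom ?G sign_img \<chi>" "group_hom ?G sign_img \<psi>"
    using a group_cpg[OF m(1)] sign_img_is_group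
    by (auto simp: is_sign_char_def group_hom_def group_hom_axioms_def)
  interpret group ?G by (rule group_cpg[OF m(1)])
  have "x \<in> {x \<in> carrier ?G. \<chi> x = \<psi> x}" if "x \<in> carrier ?G" for x
  proof (rule cgen_generate[OF m(1) that])
    show "\<one>\<^bsub>?G\<^esub> \<in> {x \<in> carrier ?G. \<chi> x = \<psi> x}"
      using h by (simp add: group_hom.hom_one)
    show "cgen m n i \<in> {x \<in> carrier ?G. \<chi> x = \<psi> x}" if "i < n" for i
      using a that cgen_carrier[OF m(1) that] by (simp add: is_sign_char_def)
    show "u \<otimes>\<^bsub>?G\<^esub> v \<in> {x \<in> carrier ?G. \<chi> x = \<psi> x}"
      if "u \<in> {x \<in> carrier ?G. \<chi> x = \<psi> x}" "v \<in> {x \<in> carrier ?G. \<chi> x = \<psi> x}" for u v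
      using that h by (simp add: group_hom.hom_mult)
  qed
  then show "\<chi> = \<psi>"
    using a by (intro extensionalityI[of _ "carrier ?G"]) (auto simp: is_sign_char_def)
qed

lemma alt_colored_iff:
  assumes "0 < r" "even r"
  shows "\<pi> \<in> alt_colored r n \<longleftrightarrow>
    \<pi> \<in> carrier (colored_perm_group r n) \<and> (-1) ^ (\<Sum>i\<in>{1..n}. fst \<pi> i) * sign (snd \<pi>) = (1 :: int)"
proof -
  have "sign_char r n =
      (\<lambda>x\<in>carrier (colored_perm_group r n). (-1) ^ (\<Sum>i\<in>{1..n}. fst x i) * sign (snd x))"
    unfolding sign_char_def
    using sign_char_unique[OF assms, of n] is_sign_char_explicit[OF assms, of n] by (rule the1_equality[of "is_sign_char r n"])
  then show ?thesis by (auto simp: alt_colored_def kernel_def sign_img_def)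
qed

end

theory Submission
  imports Defs
begin

text \<open>
  The claim is that \<open>\<ell>\<^sub>A (s \<rho>) = \<ell>\<^sub>G \<rho>\<close> for every \<open>\<rho>\<close> in \<open>G\<^bsub>r/2,n\<^esub>\<close>. Since \<open>r/2\<close> is
  odd, \<open>a \<oslash> 2\<close> is the quotient of \<open>a\<close> by 2 in the integers modulo \<open>r/2\<close>; hence the covering map is
  a homomorphism, it sends \<open>a\<^sub>i\<close> and its inverse to \<open>s\<^sub>i\<close>, and words cannot get longer under it.
  Conversely, left multiplication lifts through the section: \<open>s (s\<^sub>i \<rho>) = g s \<rho>\<close> with \<open>g\<close> either
  \<open>a\<^sub>i\<close> or, if \<open>i = 1\<close> and \<open>\<rho>\<close> has an odd number of inversions, \<open>a\<^sub>1\<inverse>\<close>. Thus any word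
  for \<open>\<rho>\<close> lifts to a word of the same length for \<open>s \<rho>\<close>.
\<close>

section \<open>Word lengths\<close>

text \<open>The right fold used in \<open>word_length\<close>: prepending a letter is left
  multiplication, which is the operation lifted below.\<close>

abbreviation word_prod :: "('a, 'b) monoid_scheme \<Rightarrow> 'a list \<Rightarrow> 'a" where
  "word_prod G ws \<equiv> foldr (\<lambda>a b. a \<otimes>\<^bsub>G\<^esub> b) ws \<one>\<^bsub>G\<^esub>"

lemma (in monoid) word_prod_closed:
  "set ws \<subseteq> carrier G \<Longrightarrow> word_prod G ws \<in> carrier G"
  by (induction ws) auto

lemma (in monoid) word_prod_append:
  assumes "set vs \<subseteq> carrier G" "set ws \<subseteq> carrier G"
  shows "word_prod G (vs @ ws) = word_prod G vs \<otimes> word_prod G ws"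
  using assms(1)
  by (induction vs) (use word_prod_closed assms(2) in \<open>auto simp: m_assoc\<close>)

text \<open>The map \<open>f\<close> need not be multiplicative: the letter \<open>t\<close> may
  depend on \<open>x\<close> as well as on \<open>s\<close>. So the section, which in general is not
  a homomorphism, is covered along with the covering map. The word is rewritten letter by letter
  from its right end.\<close>

lemma (in monoid) word_transport:
  assumes "S \<subseteq> carrier G" and "f \<one> = \<one>\<^bsub>H\<^esub>"
    and step: "\<And>s x. s \<in> S \<Longrightarrow> x \<in> carrier G \<Longrightarrow> \<exists>t\<in>T. f (s \<otimes> x) = t \<otimes>\<^bsub>H\<^esub> f x"
    and "set ws \<subseteq> S"
  shows "\<exists>vs. length vs = length ws \<and> set vs \<subseteq> T \<and> word_prod H vs = f (word_prod G ws)"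
  using assms(4)
proof (induction ws)
  case Nil
  then show ?case using assms(2) by simp
next
  case (Cons s ws)
  then obtain vs where vs: "length vs = length ws" "set vs \<subseteq> T"
      "word_prod H vs = f (word_prod G ws)"
    by auto
  have "word_prod G ws \<in> carrier G"
    using Cons.prems assms(1) by (intro word_prod_closed) auto
  then obtain t where "t \<in> T" "f (s \<otimes> word_prod G ws) = t \<otimes>\<^bsub>H\<^esub> f (word_prod G ws)"
    using step[of s "word_prod G ws"] Cons.prems by auto
  then show ?case using vs by (intro exI[of _ "t # vs"]) simp
qed

text \<open>A shortest word for \<open>x\<close> is transported. The last assumption ensures that
  one exists, since \<open>LEAST\<close> is unspecified on an empty set of lengths; for
  \<open>f x\<close> the transported word serves.\<close>

lemma (in monoid) word_length_transport_le:
  assumes "S \<subseteq> carrier G" and "f \<one> = \<one>\<^bsub>H\<^esub>"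
    and "\<And>s x. s \<in> S \<Longrightarrow> x \<in> carrier G \<Longrightarrow> \<exists>t\<in>T. f (s \<otimes> x) = t \<otimes>\<^bsub>H\<^esub> f x"
    and "\<exists>ws. set ws \<subseteq> S \<and> word_prod G ws = x"
  shows "word_length H T (f x) \<le> word_length G S x"
proof -
  have "\<exists>k ws. length ws = k \<and> set ws \<subseteq> S \<and> word_prod G ws = x"
    using assms(4) by blast
  from LeastI_ex[OF this]
  obtain ws where ws: "length ws = word_length G S x" "set ws \<subseteq> S" "word_prod G ws = x"
    unfolding word_length_def by blast
  obtain vs where "length vs = length ws" "set vs \<subseteq> T" "word_prod H vs = f x"
    using word_transport[where f = f, OF assms(1-3) ws(2)] ws(3) by auto
  then show ?thesis
    unfolding word_length_def[of H] using ws(1) by (intro Least_le) auto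
qed

text \<open>Word products contain the unit and the generators and are closed under multiplication by
  concatenation, so \<open>cgen_generate\<close> applies without inverses.\<close>

lemma cgen_word_ex:
  assumes "0 < m" "\<rho> \<in> carrier (colored_perm_group m n)"
  shows "\<exists>ws. set ws \<subseteq> cgen m n ` {0..<n} \<and> word_prod (colored_perm_group m n) ws = \<rho>"
proof -
  let ?G = "colored_perm_group m n" and ?S = "cgen m n ` {0..<n}"
  interpret group ?G by (rule group_cpg[OF assms(1)])
  have S: "?S \<subseteq> carrier ?G" using cgen_carrier[OF assms(1)] by auto
  have "\<rho> \<in> {x. \<exists>ws. set ws \<subseteq> ?S \<and> word_prod ?G ws = x}"
  proof (rule cgen_generate[OF assms])
    show "\<one>\<^bsub>?G\<^esub> \<in> {x. \<exists>ws. set ws \<subseteq> ?S \<and> word_prod ?G ws = x}"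
      by (auto intro!: exI[of _ "[]"])
    show "cgen m n i \<in> {x. \<exists>ws. set ws \<subseteq> ?S \<and> word_prod ?G ws = x}" if "i < n" for i
      using that cgen_carrier[OF assms(1) that] by (auto intro!: exI[of _ "[cgen m n i]"])
    show "u \<otimes>\<^bsub>?G\<^esub> v \<in> {x. \<exists>ws. set ws \<subseteq> ?S \<and> word_prod ?G ws = x}"
      if uv: "u \<in> {x. \<exists>ws. set ws \<subseteq> ?S \<and> word_prod ?G ws = x}"
        "v \<in> {x. \<exists>ws. set ws \<subseteq> ?S \<and> word_prod ?G ws = x}" for u v
    proof -
      obtain us vs where "set us \<subseteq> ?S" "word_prod ?G us = u" "set vs \<subseteq> ?S" "word_prod ?G vs = v"
        using uv by blast
      then show ?thesis
        using word_prod_append[of us vs] S by (auto intro!: exI[of _ "us @ vs"])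
    qed
  qed
  then show ?thesis by simp
qed

section \<open>The parity of the inversion number\<close>

lemma inversions_id: "inversions n id = 0"
proof -
  have "{(i, j). 1 \<le> i \<and> i < j \<and> j \<le> n \<and> id i > id j} = ({} :: (nat \<times> nat) set)" by auto
  then show ?thesis unfolding inversions_def by (simp only: card.empty)
qed

text \<open>Exchanging two neighbouring values affects only the comparison of these two with each
  other; their places \<open>a < b\<close> form the one new inversion.\<close>

lemma inversions_adj_transpose_Suc:
  assumes t: "\<tau> permutes {1..n}" and "1 \<le> i" "i < n"
    and less: "inv_into UNIV \<tau> i < inv_into UNIV \<tau> (i + 1)"
  shows "inversions n (Transposition.transpose i (i + 1) \<circ> \<tau>) = Suc (inversions n \<tau>)"
proof -
  let ?s = "Transposition.transpose i (i + 1)"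
  define a b where "a = inv_into UNIV \<tau> i" and "b = inv_into UNIV \<tau> (i + 1)"
  define I where "I \<sigma> = {(x, y). 1 \<le> x \<and> x < y \<and> y \<le> n \<and> \<sigma> x > \<sigma> y}" for \<sigma> :: "nat \<Rightarrow> nat"
  have ab: "\<tau> a = i" "\<tau> b = i + 1" "a < b"
    using less permutes_inverses(1)[OF t] by (auto simp: a_def b_def)
  have "\<tau> a \<in> {1..n}" "\<tau> b \<in> {1..n}" using ab assms(2,3) by auto
  then have "a \<in> {1..n}" "b \<in> {1..n}" by (simp_all only: permutes_in_image[OF t])
  \<comment> \<open>The order of two values can change only if they are \<open>i\<close> and
    \<open>i + 1\<close>; these sit at \<open>a\<close> and \<open>b\<close>, and
    \<open>x < y\<close> excludes the pair \<open>(b, a)\<close>.\<close>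
  have same: "?s (\<tau> y) < ?s (\<tau> x) \<longleftrightarrow> \<tau> y < \<tau> x" if "x < y" "(x, y) \<noteq> (a, b)" for x y
  proof -
    note eq = inj_eq[OF permutes_inj[OF t]]
    have "\<tau> x \<noteq> \<tau> y" using that(1) by (simp add: eq)
    moreover have "\<not> (\<tau> x = i \<and> \<tau> y = i + 1)" "\<not> (\<tau> x = i + 1 \<and> \<tau> y = i)"
      using that ab(3) eq[of _ a] eq[of _ b] unfolding ab(1,2) by auto
    ultimately show ?thesis by (auto simp: Transposition.transpose_def)
  qed
  have "I (?s \<circ> \<tau>) = insert (a, b) (I \<tau>)"
  proof (rule Set.set_eqI)
    fix q :: "nat \<times> nat"
    obtain x y where q: "q = (x, y)" by (cases q)
    show "q \<in> I (?s \<circ> \<tau>) \<longleftrightarrow> q \<in> insert (a, b) (I \<tau>)"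
    proof (cases "(x, y) = (a, b)")
      case True
      then show ?thesis using ab \<open>a \<in> _\<close> \<open>b \<in> _\<close> by (auto simp: I_def q)
    next
      case False
      then show ?thesis using same[of x y] by (auto simp: I_def q)
    qed
  qed
  moreover have "finite (I \<tau>)"
    by (rule finite_subset[of _ "{1..n} \<times> {1..n}"]) (auto simp: I_def)
  moreover have "(a, b) \<notin> I \<tau>" using ab by (simp add: I_def)
  moreover have "inversions n \<sigma> = card (I \<sigma>)" for \<sigma>
    unfolding inversions_def I_def ..
  ultimately show ?thesis by simp
qed

lemma even_inversions_adj_transpose:
  assumes t: "\<tau> permutes {1..n}" and i: "1 \<le> i" "i < n"
  shows "even (inversions n (Transposition.transpose i (i + 1) \<circ> \<tau>)) \<longleftrightarrow> odd (inversions n \<tau>)"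
proof -
  let ?s = "Transposition.transpose i (i + 1)"
  let ?a = "inv_into UNIV \<tau> i" and ?b = "inv_into UNIV \<tau> (i + 1)"
  have "?a \<noteq> ?b" by (simp add: inj_eq[OF permutes_inj[OF permutes_inv[OF t]]])
  then consider "?a < ?b" | "?b < ?a" by linarith
  then show ?thesis
  proof cases
    case 1
    from inversions_adj_transpose_Suc[OF t i this] show ?thesis by simp
  next
    case 2
    \<comment> \<open>In \<open>?s \<circ> \<tau>\<close> the places of \<open>i\<close> and
      \<open>i + 1\<close> are exchanged, so the previous lemma applies to it, and a second
      \<open>?s\<close> leads back to \<open>\<tau>\<close>.\<close>
    have s: "?s permutes {1..n}" using i by (intro permutes_swap_id) auto
    have st: "?s \<circ> \<tau> permutes {1..n}" by (rule permutes_compose[OF t s])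
    have "inv_into UNIV (?s \<circ> \<tau>) = inv_into UNIV \<tau> \<circ> ?s"
      using o_inv_distrib[OF permutes_bij[OF s] permutes_bij[OF t]] by simp
    then have "inv_into UNIV (?s \<circ> \<tau>) i < inv_into UNIV (?s \<circ> \<tau>) (i + 1)"
      using 2 by simp
    from inversions_adj_transpose_Suc[OF st i this]
    have "inversions n (?s \<circ> (?s \<circ> \<tau>)) = Suc (inversions n (?s \<circ> \<tau>))" .
    moreover have "?s \<circ> (?s \<circ> \<tau>) = \<tau>" by (rule ext) simp
    ultimately have "inversions n \<tau> = Suc (inversions n (?s \<circ> \<tau>))" by (rule back_subst)
    then show ?thesis by (simp del: One_nat_def)
  qed
qed

section \<open>Generators, covering map and section in coordinates\<close>

lemma cgen0_pow:
  assumes "0 < m"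
  shows "cgen m n 0 [^]\<^bsub>colored_perm_group m n\<^esub> (k::nat)
    = (\<lambda>j\<in>{1..n}. if j = 1 then k mod m else 0, id)"
proof -
  interpret group "colored_perm_group m n" by (rule group_cpg[OF assms])
  show ?thesis
    by (induction k) (auto simp: one_cpg mult_cpg cgen_def mod_simps fun_eq_iff)
qed

text \<open>The reduction \<open>2 mod r\<close> matters for \<open>r = 2\<close>, where this
  generator is the identity.\<close>

lemma agen_0: "0 < r \<Longrightarrow> agen r n 0 = (\<lambda>j\<in>{1..n}. if j = 1 then 2 mod r else 0, id)"
  by (simp add: agen_def cgen0_pow)

lemma transpose_adj_in:
  fixes i k n :: nat
  assumes "0 < i" "i < n" "k \<in> {1..n}"
  shows "Transposition.transpose i (i + 1) k \<in> {1..n}"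
  using assms by (auto simp: Transposition.transpose_def)

lemma agen_pos:
  assumes "0 < r" "0 < i" "i < n"
  shows "agen r n i
    = (\<lambda>j\<in>{1..n}. if j = 1 then r div 2 else 0, Transposition.transpose i (i + 1))"
proof -
  have "r div 2 mod r = r div 2" using assms(1) by simp
  then show ?thesis
    using assms unfolding agen_def cgen0_pow[OF assms(1)]
    by (auto simp: cgen_def mult_cpg intro!: restrict_ext)
qed

text \<open>The color \<open>r div 2\<close> is its own negative modulo \<open>r\<close>; inverting
  moves it past the transposition, hence from digit 1 to digit 2.\<close>

lemma inv_agen_1:
  assumes "0 < r" "even r" "2 \<le> n"
  shows "inv\<^bsub>colored_perm_group r n\<^esub> (agen r n 1)
    = (\<lambda>j\<in>{1..n}. if j = 2 then r div 2 else 0, Transposition.transpose 1 2)"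
    (is "_ = ?x")
proof -
  let ?G = "colored_perm_group r n"
  interpret group ?G by (rule group_cpg[OF assms(1)])
  let ?t = "Transposition.transpose 1 (2::nat)"
  have t: "?t permutes {1..n}" using assms by (intro permutes_swap_id) auto
  have a: "agen r n 1 = (\<lambda>j\<in>{1..n}. if j = 1 then r div 2 else 0, ?t)"
    using agen_pos[of r 1 n] assms by (simp add: numeral_2_eq_2)
  have ac: "agen r n 1 \<in> carrier ?G" "?x \<in> carrier ?G"
    using t assms unfolding a by (auto simp: carrier_cpg)
  have r: "r div 2 + r div 2 = r" using assms by (auto elim!: evenE)
  have "?x \<otimes>\<^bsub>?G\<^esub> agen r n 1 = \<one>\<^bsub>?G\<^esub>"
    unfolding a mult_cpg one_cpg prod.inject
  proof (intro conjI restrict_ext)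
    fix k assume k: "k \<in> {1..n}"
    have "?t k \<in> {1..n}" using k assms by (auto simp: Transposition.transpose_def)
    moreover have "?t k = 1 \<longleftrightarrow> k = 2" by (auto simp: Transposition.transpose_def)
    ultimately show "((\<lambda>j\<in>{1..n}. if j = 2 then r div 2 else 0) k
        + (\<lambda>j\<in>{1..n}. if j = 1 then r div 2 else 0) (inv_into UNIV ?t k)) mod r = 0"
      using k r by simp
  qed simp
  then show ?thesis using ac by (metis inv_equality)
qed

text \<open>The color in place \<open>i\<close> belongs to the digit \<open>\<tau> i\<close>, so
  recoloring a window acts coordinatewise on the vector. \<open>f\<close> may depend on the digit
  because the section singles out the digit 1.\<close>

lemma window_colors:
  assumes "\<tau> permutes {1..n}"
  shows "window n \<tau> (\<lambda>i. f (\<tau> i) (color (z, \<tau>) i)) = (\<lambda>k\<in>{1..n}. f k (z k), \<tau>)"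
  by (simp add: window_def color_def permutes_inverses[OF assms])

lemma cover_pair:
  "\<tau> permutes {1..n} \<Longrightarrow> cover r n (z, \<tau>) = (\<lambda>k\<in>{1..n}. half_color r (z k), \<tau>)"
  using window_colors[of \<tau> n "\<lambda>_. half_color r" z] by (simp add: cover_def)

lemma cover_section_pair:
  "\<tau> permutes {1..n} \<Longrightarrow> cover_section r n (z, \<tau>) =
    (\<lambda>k\<in>{1..n}. if odd (inversions n \<tau>) \<and> k = 1 then (2 * z k + r div 2) mod r
      else (2 * z k) mod r, \<tau>)"
  using window_colors[of \<tau> n "\<lambda>k c. if odd (inversions n \<tau>) \<and> k = 1
      then (2 * c + r div 2) mod r else (2 * c) mod r" z]
  by (simp add: cover_section_def)

text \<open>For odd \<open>m\<close> the number \<open>(m + 1) div 2\<close> is the inverse of 2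
  modulo \<open>m\<close>; the summand \<open>m\<close> in the odd case does not change the
  residue.\<close>

lemma half_color_eq:
  assumes "odd m"
  shows "half_color (2 * m) a = a * ((m + 1) div 2) mod m"
proof -
  obtain q where q: "m = 2 * q + 1" using assms by (elim oddE)
  have h: "(m + 1) div 2 = q + 1" using q by simp
  show ?thesis
  proof (cases "even a")
    case True
    then obtain b where b: "a = 2 * b" by (elim evenE)
    have e: "a * (q + 1) = b + b * m" by (simp add: b q algebra_simps)
    show ?thesis using True unfolding half_color_def h e by (simp add: b)
  next
    case False
    then obtain b where b: "a = 2 * b + 1" by (elim oddE)
    have e: "a * (q + 1) = (b + q + 1) + b * m" by (simp add: b q algebra_simps)
    have "(a + m) div 2 = b + q + 1" by (simp add: b q)
    then show ?thesis using False unfolding half_color_def h e by simp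
  qed
qed

text \<open>Since \<open>m\<close> divides \<open>2 * m\<close>, the inner reduction is invisible
  modulo \<open>m\<close>, and multiplication by a fixed factor is additive.\<close>

lemma half_color_add:
  assumes "odd m"
  shows "half_color (2 * m) ((a + b) mod (2 * m))
    = (half_color (2 * m) a + half_color (2 * m) b) mod m"
proof -
  have "[(a + b) mod (2 * m) = a + b] (mod m)"
    by (metis cong_dvd_modulus_nat cong_mod_left dvd_triv_right cong_refl)
  then have "[(a + b) mod (2 * m) * ((m + 1) div 2) = (a + b) * ((m + 1) div 2)] (mod m)"
    by (rule cong_scalar_right)
  then show ?thesis
    unfolding half_color_eq[OF assms] by (simp add: cong_def mod_simps add_mult_distrib)
qed

text \<open>Halving kills the color \<open>m\<close>. Hence both the factors \<open>s_0^m\<close> in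
  the generators and the correction made by the section disappear under the covering map.\<close>

lemma half_color_simps:
  assumes "odd m"
  shows "half_color (2 * m) 0 = 0" "half_color (2 * m) m = 0"
    "half_color (2 * m) (2 * c) = c mod m"
    "half_color (2 * m) ((2 * c + m) mod (2 * m)) = c mod m"
proof -
  show "half_color (2 * m) 0 = 0" "half_color (2 * m) (2 * c) = c mod m"
    by (simp_all add: half_color_def)
  moreover show "half_color (2 * m) m = 0" using assms by (simp add: half_color_def)
  ultimately show "half_color (2 * m) ((2 * c + m) mod (2 * m)) = c mod m"
    unfolding half_color_add[OF assms] by simp
qed

section \<open>The covering map and the section respect the generators\<close>

lemma cover_closed:
  assumes "odd m" "\<pi> \<in> carrier (colored_perm_group (2 * m) n)"
  shows "cover (2 * m) n \<pi> \<in> carrier (colored_perm_group m n)"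
proof -
  obtain z \<tau> where p: "\<pi> = (z, \<tau>)" by (cases \<pi>)
  have "\<tau> permutes {1..n}" using assms by (simp add: p carrier_cpg)
  then show ?thesis
    using assms by (auto simp: p cover_pair carrier_cpg half_color_eq odd_pos)
qed

lemma cover_mult:
  assumes "odd m" "x \<in> carrier (colored_perm_group (2 * m) n)"
    "y \<in> carrier (colored_perm_group (2 * m) n)"
  shows "cover (2 * m) n (x \<otimes>\<^bsub>colored_perm_group (2 * m) n\<^esub> y)
    = cover (2 * m) n x \<otimes>\<^bsub>colored_perm_group m n\<^esub> cover (2 * m) n y"
proof -
  obtain z t w u where e: "x = (z, t)" "y = (w, u)" by (metis surj_pair)
  have t: "t permutes {1..n}" and u: "u permutes {1..n}"
    using assms by (auto simp: e carrier_cpg)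
  have "inv_into UNIV t k \<in> {1..n}" if "k \<in> {1..n}" for k
    using permutes_in_image[OF permutes_inv[OF t], of k] that by simp
  then show ?thesis
    unfolding e mult_cpg cover_pair[OF t] cover_pair[OF u] cover_pair[OF permutes_compose[OF u t]]
    by (auto simp: half_color_add[OF assms(1)] intro!: restrict_ext)
qed

lemma alt_gens_carrier:
  assumes "0 < r"
  shows "alt_gens r n \<subseteq> carrier (colored_perm_group r n)"
proof -
  interpret group "colored_perm_group r n" by (rule group_cpg[OF assms])
  have "agen r n i \<in> carrier (colored_perm_group r n)" if "i < n" for i
    using that cgen_carrier[OF assms, of _ n] by (auto simp: agen_def)
  then show ?thesis by (auto simp: alt_gens_def)
qed

text \<open>The color 2 of \<open>a_0\<close> halves to the color 1 of \<open>s_0\<close>; the color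
  \<open>m\<close> of the other generators halves to 0 and leaves the bare transposition.\<close>

lemma cover_alt_gens:
  assumes "odd m" "g \<in> alt_gens (2 * m) n"
  shows "cover (2 * m) n g \<in> cgen m n ` {0..<n}"
proof -
  have r: "0 < 2 * m" using assms(1) by (simp add: odd_pos)
  note h = half_color_simps[OF assms(1)]
  have "(\<exists>i<n. g = agen (2 * m) n i)
      \<or> 2 \<le> n \<and> g = inv\<^bsub>colored_perm_group (2 * m) n\<^esub> (agen (2 * m) n 1)"
    using assms(2) by (auto simp: alt_gens_def split: if_splits)
  then consider "0 < n" "g = agen (2 * m) n 0" | i where "0 < i" "i < n" "g = agen (2 * m) n i"
    | "2 \<le> n" "g = inv\<^bsub>colored_perm_group (2 * m) n\<^esub> (agen (2 * m) n 1)"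
    by (metis gr0I)
  then show ?thesis
  proof cases
    case 1
    \<comment> \<open>Here \<open>2 mod (2 * m)\<close> is rewritten as
      \<open>2 * (1 mod m)\<close>, which is also right for \<open>m = 1\<close>.\<close>
    have "half_color (2 * m) (2 mod (2 * m)) = 1 mod m"
      by (metis h(3) mult_mod_right mod_mod_trivial mult_1_right)
    then have "cover (2 * m) n g = cgen m n 0"
      unfolding 1 agen_0[OF r] cover_pair[OF permutes_id]
      by (auto simp: cgen_def h intro!: restrict_ext)
    then show ?thesis using 1 by auto
  next
    case (2 i)
    have t: "Transposition.transpose i (i + 1) permutes {1..n}"
      using 2 by (intro permutes_swap_id) auto
    have "cover (2 * m) n g = cgen m n i"
      unfolding 2(3) agen_pos[OF r 2(1,2)] cover_pair[OF t]
      using 2 by (auto simp: cgen_def h intro!: restrict_ext)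
    then show ?thesis using 2 by auto
  next
    case 3
    have t: "Transposition.transpose 1 2 permutes {1..n}"
      using 3 by (intro permutes_swap_id) auto
    have c: "cgen m n 1 = (\<lambda>k\<in>{1..n}. 0, Transposition.transpose 1 2)"
      by (simp add: cgen_def numeral_2_eq_2)
    have "even (2 * m)" by simp
    from inv_agen_1[OF r this 3(1)] have "cover (2 * m) n g = cgen m n 1"
      unfolding 3(2) c by (simp only: cover_pair[OF t]) (auto simp: h intro!: restrict_ext)
    then show ?thesis using 3 by auto
  qed
qed

lemma cover_one: "odd m \<Longrightarrow> cover (2 * m) n \<one>\<^bsub>colored_perm_group (2 * m) n\<^esub> = \<one>\<^bsub>colored_perm_group m n\<^esub>"
  by (auto simp: one_cpg cover_pair[OF permutes_id] half_color_simps intro!: restrict_ext)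

lemma cover_section_one:
  "cover_section r n \<one>\<^bsub>colored_perm_group m n\<^esub> = \<one>\<^bsub>colored_perm_group r n\<^esub>"
  by (auto simp: one_cpg cover_section_pair[OF permutes_id] inversions_id intro!: restrict_ext)

lemma cover_cover_section:
  assumes "odd m" "\<rho> \<in> carrier (colored_perm_group m n)"
  shows "cover (2 * m) n (cover_section (2 * m) n \<rho>) = \<rho>"
proof -
  obtain z \<tau> where p: "\<rho> = (z, \<tau>)" by (cases \<rho>)
  have t: "\<tau> permutes {1..n}" and z: "z \<in> {1..n} \<rightarrow>\<^sub>E {0..<m}"
    using assms by (auto simp: p carrier_cpg)
  have "z k mod m = z k" if "k \<in> {1..n}" for k using z that by (auto simp: PiE_def Pi_def)
  then show ?thesis
    using z half_color_simps[OF assms(1)] unfolding p cover_section_pair[OF t] cover_pair[OF t]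
    by (auto simp: fun_eq_iff PiE_def extensional_def)
qed

text \<open>\<open>s_0\<close> keeps the permutation and adds 2 to a doubled color. Every other
  \<open>s_i\<close> flips the parity of the inversions, so the extra \<open>m\<close> on digit 1
  has to appear or vanish. For \<open>i > 1\<close> digit 1 stays in place and \<open>a_i\<close>
  toggles its \<open>m\<close>. For \<open>i = 1\<close> an existing \<open>m\<close> is carried to
  digit 2, where it has to be cancelled; \<open>a_1^{-1}\<close> does this, as its color sits on
  digit 2.\<close>

lemma cover_section_cgen_mult:
  assumes m: "0 < m" and i: "i < n" and \<rho>: "\<rho> \<in> carrier (colored_perm_group m n)"
  shows "\<exists>g\<in>alt_gens (2 * m) n. cover_section (2 * m) n (cgen m n i \<otimes>\<^bsub>colored_perm_group m n\<^esub> \<rho>)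
    = g \<otimes>\<^bsub>colored_perm_group (2 * m) n\<^esub> cover_section (2 * m) n \<rho>"
proof -
  have r: "0 < 2 * m" using m by simp
  obtain z \<tau> where p: "\<rho> = (z, \<tau>)" by (cases \<rho>)
  have t: "\<tau> permutes {1..n}" and z: "z \<in> {1..n} \<rightarrow>\<^sub>E {0..<m}"
    using \<rho> by (auto simp: p carrier_cpg)
  have zk: "z k < m" if "k \<in> {1..n}" for k using z that by auto
  show ?thesis
  proof (cases "i = 0")
    case True
    have dbl: "2 * (Suc c mod m) = Suc (Suc (2 * c)) mod (2 * m)" for c
      by (simp only: mult_mod_right mult_Suc_right add_2_eq_Suc)
    have "cgen m n i \<otimes>\<^bsub>colored_perm_group m n\<^esub> \<rho>
        = (\<lambda>k\<in>{1..n}. if k = 1 then (1 mod m + z k) mod m else z k, \<tau>)"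
      using zk by (auto simp: True p cgen_def mult_cpg intro!: restrict_ext)
    moreover have "agen (2 * m) n 0 \<otimes>\<^bsub>colored_perm_group (2 * m) n\<^esub> cover_section (2 * m) n \<rho>
        = (\<lambda>k\<in>{1..n}. if odd (inversions n \<tau>) \<and> k = 1 then ((2 + 2 * z k) mod (2 * m) + m) mod (2 * m)
            else if k = 1 then (2 + 2 * z k) mod (2 * m) else 2 * z k mod (2 * m), \<tau>)"
      unfolding p agen_0[OF r] cover_section_pair[OF t] mult_cpg prod.inject inv_id
      using zk by (intro conjI restrict_ext)
         (auto simp: mod_add_left_eq mod_add_right_eq add.assoc)
    ultimately have "cover_section (2 * m) n (cgen m n i \<otimes>\<^bsub>colored_perm_group m n\<^esub> \<rho>)
      = agen (2 * m) n 0 \<otimes>\<^bsub>colored_perm_group (2 * m) n\<^esub> cover_section (2 * m) n \<rho>"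
      by (auto simp: cover_section_pair[OF t] dbl intro!: restrict_ext)
    then show ?thesis using i by (force simp: alt_gens_def)
  next
    case False
    let ?s = "Transposition.transpose i (i + 1)"
    let ?o = "odd (inversions n \<tau>)"
    define g where "g = (if ?o \<and> i = 1 then inv\<^bsub>colored_perm_group (2 * m) n\<^esub> (agen (2 * m) n 1)
      else agen (2 * m) n i)"
    \<comment> \<open>One formula for both choices of \<open>g\<close>: they differ only in the
      digit that carries \<open>m\<close>.\<close>
    have g: "g = (\<lambda>j\<in>{1..n}. if j = (if ?o \<and> i = 1 then 2 else 1) then m else 0, ?s)"
    proof (cases "?o \<and> i = 1")
      case True
      then have n: "2 \<le> n" and s: "?s = Transposition.transpose 1 2"
        using i by (auto simp: numeral_2_eq_2)
      have "even (2 * m)" by simp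
      from inv_agen_1[OF r this n] show ?thesis using True unfolding g_def s by (simp cong: if_cong)
    next
      case c: False
      have "0 < i" using False by simp
      from agen_pos[OF r this i] show ?thesis
        using c by (simp only: g_def if_False nonzero_mult_div_cancel_left zero_neq_numeral not_False_eq_True)
    qed
    have s: "?s permutes {1..n}" using False i by (intro permutes_swap_id) auto
    have inv_s: "inv_into UNIV ?s = ?s" and half: "2 * m div 2 = m" by simp_all
    have sk: "?s k \<in> {1..n}" if "k \<in> {1..n}" for k
      using transpose_adj_in[of i n k] that i False by simp
    have "cgen m n i \<otimes>\<^bsub>colored_perm_group m n\<^esub> \<rho> = (\<lambda>k\<in>{1..n}. z (?s k), ?s \<circ> \<tau>)"
      using False i zk sk by (auto simp: cgen_def p mult_cpg intro!: restrict_ext)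
    moreover have "even (inversions n (?s \<circ> \<tau>)) \<longleftrightarrow> ?o"
      using even_inversions_adj_transpose[OF t, of i] False i by simp
    moreover have "g \<otimes>\<^bsub>colored_perm_group (2 * m) n\<^esub> cover_section (2 * m) n \<rho>
      = (\<lambda>k\<in>{1..n}. if \<not> ?o \<and> k = 1 then (2 * z (?s k) + m) mod (2 * m)
          else 2 * z (?s k) mod (2 * m), ?s \<circ> \<tau>)"
      unfolding g p cover_section_pair[OF t] mult_cpg prod.inject
    proof (intro conjI restrict_ext)
      fix k assume k: "k \<in> {1..n}"
      have "((if k = (if ?o \<and> i = 1 then 2 else 1) then m else 0)
          + (if ?o \<and> ?s k = 1 then (2 * z (?s k) + m) mod (2 * m) else 2 * z (?s k) mod (2 * m))) mod (2 * m)
        = (if \<not> ?o \<and> k = 1 then (2 * z (?s k) + m) mod (2 * m) else 2 * z (?s k) mod (2 * m))"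
      proof -
        \<comment> \<open>Coordinate \<open>k\<close> of the product reads coordinate
          \<open>?s k\<close> of the section; this locates the digit that receives the old extra
          \<open>m\<close>.\<close>
        have s1: "?s k = 1 \<longleftrightarrow> (if i = 1 then k = 2 else k = 1)"
          using False by (auto simp: Transposition.transpose_def)
        \<comment> \<open>The doubled color without and with the extra \<open>m\<close>. Adding
          \<open>m\<close> exchanges them modulo \<open>2 * m\<close>, so a finite case check
          remains.\<close>
        define X Y where "X = 2 * z (?s k) mod (2 * m)" and "Y = (2 * z (?s k) + m) mod (2 * m)"
        have "(m + X) mod (2 * m) = Y"
          unfolding X_def Y_def mod_add_right_eq by (simp only: add.commute)
        moreover have "(m + Y) mod (2 * m) = (2 * z (?s k) + 2 * m) mod (2 * m)"
          unfolding Y_def mod_add_right_eq by (rule arg_cong[where f = "\<lambda>x. x mod (2 * m)"]) simp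
        then have "(m + Y) mod (2 * m) = X" by (simp only: X_def mod_add_self2)
        moreover have "X mod (2 * m) = X" "Y mod (2 * m) = Y"
          by (simp_all only: X_def Y_def mod_mod_trivial)
        ultimately show ?thesis
          unfolding s1 X_def[symmetric] Y_def[symmetric]
          by (cases ?o; cases "i = 1"; cases "k = 1"; cases "k = 2")
            (simp_all only: if_True if_False simp_thms add_0 one_eq_numeral_iff num.distinct)
      qed
      then show "((\<lambda>j\<in>{1..n}. if j = (if ?o \<and> i = 1 then 2 else 1) then m else 0) k
          + (\<lambda>k\<in>{1..n}. if ?o \<and> k = 1 then (2 * z k + 2 * m div 2) mod (2 * m)
              else 2 * z k mod (2 * m)) (inv_into UNIV ?s k)) mod (2 * m)
        = (if \<not> ?o \<and> k = 1 then (2 * z (?s k) + m) mod (2 * m) else 2 * z (?s k) mod (2 * m))"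
        by (simp only: restrict_apply'[OF k] restrict_apply'[OF sk[OF k]] inv_s half)
    qed simp
    ultimately have "cover_section (2 * m) n (cgen m n i \<otimes>\<^bsub>colored_perm_group m n\<^esub> \<rho>)
      = g \<otimes>\<^bsub>colored_perm_group (2 * m) n\<^esub> cover_section (2 * m) n \<rho>"
      by (simp only: cover_section_pair[OF permutes_compose[OF t s]] half prod.inject simp_thms)
        (intro restrict_ext, simp only: restrict_apply')
    moreover have "g \<in> alt_gens (2 * m) n"
      using i False by (auto simp: g_def alt_gens_def)
    ultimately show ?thesis by blast
  qed
qed

section \<open>Comparison of the two word lengths\<close>

lemma length_A_cover_section:
  assumes "odd m" and \<rho>: "\<rho> \<in> carrier (colored_perm_group m n)"
  shows "length_A (2 * m) n (cover_section (2 * m) n \<rho>) = length_G m n \<rho>"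
proof -
  let ?G = "colored_perm_group m n" and ?A = "colored_perm_group (2 * m) n"
  have m: "0 < m" and r: "0 < 2 * m" using assms(1) by (simp_all add: odd_pos)
  interpret G: group ?G by (rule group_cpg[OF m])
  interpret A: group ?A by (rule group_cpg[OF r])
  note A = alt_gens_carrier[OF r, of n]
  have G: "cgen m n ` {0..<n} \<subseteq> carrier ?G" using cgen_carrier[OF m] by auto
  have lift: "\<exists>t\<in>alt_gens (2 * m) n.
      cover_section (2 * m) n (s \<otimes>\<^bsub>?G\<^esub> x) = t \<otimes>\<^bsub>?A\<^esub> cover_section (2 * m) n x"
    if "s \<in> cgen m n ` {0..<n}" "x \<in> carrier ?G" for s x
    using that(1) cover_section_cgen_mult[OF m _ that(2)] by auto
  have proj: "\<exists>t\<in>cgen m n ` {0..<n}. cover (2 * m) n (s \<otimes>\<^bsub>?A\<^esub> x) = t \<otimes>\<^bsub>?G\<^esub> cover (2 * m) n x"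
    if "s \<in> alt_gens (2 * m) n" "x \<in> carrier ?A" for s x
    using that A cover_alt_gens[OF assms(1) that(1)] cover_mult[OF assms(1), of s n x]
    by (intro bexI[of _ "cover (2 * m) n s"]) auto
  note words = cgen_word_ex[OF m \<rho>]
  \<comment> \<open>Lifting a word for \<open>\<rho>\<close> gives one for its section, so the
    minimum defining \<open>length_A\<close> is attained there.\<close>
  have words': "\<exists>vs. set vs \<subseteq> alt_gens (2 * m) n \<and> word_prod ?A vs = cover_section (2 * m) n \<rho>"
    using words G.word_transport[where f = "cover_section (2 * m) n", OF G cover_section_one lift]
    by blast
  have "length_A (2 * m) n (cover_section (2 * m) n \<rho>) \<le> length_G m n \<rho>"
    unfolding length_A_def length_G_def
    by (rule G.word_length_transport_le[where f = "cover_section (2 * m) n", OF G cover_section_one lift words])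
  \<comment> \<open>Projecting a shortest word for the section gives a word for
    \<open>\<rho>\<close>, because the covering map undoes the section.\<close>
  moreover have "length_G m n (cover (2 * m) n (cover_section (2 * m) n \<rho>))
      \<le> length_A (2 * m) n (cover_section (2 * m) n \<rho>)"
    unfolding length_A_def length_G_def
    by (rule A.word_length_transport_le[where f = "cover (2 * m) n", OF A cover_one[OF assms(1)] proj words'])
  ultimately show ?thesis using cover_cover_section[OF assms] by simp
qed

theorem corollary6p11:
  fixes r n :: nat and \<pi> :: "(nat \<Rightarrow> nat) \<times> (nat \<Rightarrow> nat)"
  assumes "0 < r" and "0 < n" and "[r = 2] (mod 4)"
    and "\<pi> \<in> alt_colored r n"
  shows "int (length_A r n \<pi>) = fibral_length r n \<pi> + int (length_G (r div 2) n (cover r n \<pi>))"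
proof -
  define m where "m = r div 2"
  have "r mod 4 = 2" using assms(3) by (simp add: cong_def)
  then have r: "r = 2 * m" and m: "odd m" unfolding m_def by presburger+
  have "\<pi> \<in> carrier (colored_perm_group (2 * m) n)"
    using assms(4) by (simp add: alt_colored_def kernel_def r)
  \<comment> \<open>For \<rho> the projection of \<pi>, the length subtracted in
    \<open>fibral_length\<close> is \<open>length_G\<close> of \<rho>, so the two terms
    cancel.\<close>
  from length_A_cover_section[OF m cover_closed[OF m this]] show ?thesis
    by (simp add: fibral_length_def r)
qed

end
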